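(* Let $p$ be a prime, $n\ge1$, and let $\xi_0,\dots,\xi_{n-1}$ be i.i.d. random variables taking values in $\mathbb{Z}_p$ such that $\xi_i\bmod p$ is a non-constant random variable. Let $f(X)=\xi_0+\xi_1X+\dots+\xi_{n-1}X^{n-1}+X^n$ and $f_0(X)=f(pX)$. Then $$\mathbb{E}\left[C_{\mathbb{Z}_p}(f_0)\right]\le\frac{\mathbb{P}\left(\xi_0\equiv0\pmod p\right)}{\mathbb{P}\left(\xi_0\not\equiv0\pmod p\right)}.$$
   Context: $\mathbb{Z}_p$ is the ring of $p$-adic integers. $C_{\mathbb{Z}_p}(g)=\#\{x\in\mathbb{Z}_p:g(x)=0\}$ is the number of roots of $g$ in $\mathbb{Z}_p$, counted without multiplicities. *)

theory Defs
  imports "HOL-Probability.Probability" "HOL-Algebra.UnivPoly" "HOL-Number_Theory.Cong"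
begin

text \<open>The $p$-adic integers as the inverse limit of the rings $\mathbb{Z}/p^k$: an element is
  the sequence of its residues modulo $p^k$, each represented in $\{0,\dots,p^k-1\}$.\<close>

definition padic_int :: "nat \<Rightarrow> (nat \<Rightarrow> int) ring" where
  "padic_int p =
    \<lparr> carrier = {x. \<forall>k. x k \<in> {0..<int p ^ k} \<and> x (Suc k) mod int p ^ k = x k},
      monoid.mult = (\<lambda>x y k. (x k * y k) mod int p ^ k),
      monoid.one = (\<lambda>k. 1 mod int p ^ k),
      ring.zero = (\<lambda>k. 0),
      ring.add = (\<lambda>x y k. (x k + y k) mod int p ^ k) \<rparr>"

text \<open>Reduction modulo $p$, with values in $\{0,\dots,p-1\}$.\<close>

definition padic_mod_p :: "(nat \<Rightarrow> int) \<Rightarrow> int" where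
  "padic_mod_p x = x 1"

text \<open>The inverse limit topology, the factors $\mathbb{Z}/p^k$ being discrete; this is the
  $p$-adic topology.\<close>

definition padic_topology :: "nat \<Rightarrow> (nat \<Rightarrow> int) topology" where
  "padic_topology p =
    subtopology (product_topology (\<lambda>k. discrete_topology UNIV) UNIV) (carrier (padic_int p))"

definition padic_borel :: "nat \<Rightarrow> (nat \<Rightarrow> int) measure" where
  "padic_borel p = sigma (carrier (padic_int p)) {U. openin (padic_topology p) U}"

definition monic_poly :: "('a, 'm) ring_scheme \<Rightarrow> nat \<Rightarrow> (nat \<Rightarrow> 'a) \<Rightarrow> nat \<Rightarrow> 'a" where
  "monic_poly R n a =
    (\<Oplus>\<^bsub>UP R\<^esub>i\<in>{..<n}. monom (UP R) (a i) i) \<oplus>\<^bsub>UP R\<^esub> monom (UP R) \<one>\<^bsub>R\<^esub> n"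

text \<open>The composition $f(g(X))$: evaluation of $f$ at the element $g$ of the $R$-algebra $R[X]$.\<close>

definition poly_subst ::
  "('a, 'm) ring_scheme \<Rightarrow> (nat \<Rightarrow> 'a) \<Rightarrow> (nat \<Rightarrow> 'a) \<Rightarrow> nat \<Rightarrow> 'a" where
  "poly_subst R f g = eval R (UP R) (\<lambda>a. monom (UP R) a 0) g f"

text \<open>Roots are counted without multiplicity.  A nonzero polynomial over the domain
  $\mathbb{Z}_p$ has finitely many roots, so for such $g$ the cardinality is the true count.\<close>

definition padic_root_count :: "nat \<Rightarrow> (nat \<Rightarrow> (nat \<Rightarrow> int)) \<Rightarrow> nat" where
  "padic_root_count p g =
    card {x \<in> carrier (padic_int p).
      eval (padic_int p) (padic_int p) id x g = \<zero>\<^bsub>padic_int p\<^esub>}"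

lemma padic_int_simps:
  "x \<in> carrier (padic_int p) \<longleftrightarrow>
     (\<forall>k. x k \<in> {0..<int p ^ k} \<and> x (Suc k) mod int p ^ k = x k)"
  "x \<otimes>\<^bsub>padic_int p\<^esub> y = (\<lambda>k. (x k * y k) mod int p ^ k)"
  "x \<oplus>\<^bsub>padic_int p\<^esub> y = (\<lambda>k. (x k + y k) mod int p ^ k)"
  "\<one>\<^bsub>padic_int p\<^esub> = (\<lambda>k. 1 mod int p ^ k)"
  "\<zero>\<^bsub>padic_int p\<^esub> = (\<lambda>k. 0)"
  unfolding padic_int_def by simp_all

lemma padic_seqI:
  assumes "p > 0" and "\<And>k. [c (Suc k) = c k] (mod int p ^ k)"
  shows "(\<lambda>k. c k mod int p ^ k) \<in> carrier (padic_int p)"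
  using assms by (auto simp: padic_int_simps cong_def mod_mod_cancel)

lemma padic_cong:
  assumes "x \<in> carrier (padic_int p)"
  shows "[x (Suc k) = x k] (mod int p ^ k)"
  using assms unfolding padic_int_simps cong_def by (metis mod_mod_trivial)

lemma padic_mod_self:
  assumes "x \<in> carrier (padic_int p)"
  shows "x k mod int p ^ k = x k"
  using assms by (auto simp: padic_int_simps)

lemma cring_padic_int:
  assumes "p > 0"
  shows "cring (padic_int p)"
proof (rule cringI)
  show "abelian_group (padic_int p)"
  proof (rule abelian_groupI)
    fix x assume x: "x \<in> carrier (padic_int p)"
    have "(\<lambda>k. (- x k) mod int p ^ k) \<in> carrier (padic_int p)"
      using assms padic_cong[OF x] by (intro padic_seqI) (auto simp: cong_minus_minus_iff)
    moreover have "(\<lambda>k. (- x k) mod int p ^ k) \<oplus>\<^bsub>padic_int p\<^esub> x = \<zero>\<^bsub>padic_int p\<^esub>"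
      by (simp add: padic_int_simps mod_simps)
    ultimately show "\<exists>y\<in>carrier (padic_int p). y \<oplus>\<^bsub>padic_int p\<^esub> x = \<zero>\<^bsub>padic_int p\<^esub>"
      by blast
  next
    fix x y assume "x \<in> carrier (padic_int p)" "y \<in> carrier (padic_int p)"
    then show "x \<oplus>\<^bsub>padic_int p\<^esub> y \<in> carrier (padic_int p)"
      unfolding padic_int_simps(3)
      by (intro padic_seqI assms cong_add padic_cong)
  qed (use assms in \<open>auto simp: padic_int_simps mod_simps add_ac\<close>)
  show "comm_monoid (padic_int p)"
  proof (rule comm_monoidI)
    fix x y assume "x \<in> carrier (padic_int p)" "y \<in> carrier (padic_int p)"
    then show "x \<otimes>\<^bsub>padic_int p\<^esub> y \<in> carrier (padic_int p)"
      unfolding padic_int_simps(2)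
      by (intro padic_seqI assms cong_mult padic_cong)
  next
    show "\<one>\<^bsub>padic_int p\<^esub> \<in> carrier (padic_int p)"
      unfolding padic_int_simps(4) by (intro padic_seqI assms cong_refl)
  qed (auto simp: padic_int_simps(2,4) padic_mod_self mod_simps mult_ac)
qed (auto simp: padic_int_simps(2,3) mod_simps algebra_simps)

lemma padic_nat_pow_one:
  assumes "p > 0"
  shows "add_pow (padic_int p) (m::nat) \<one>\<^bsub>padic_int p\<^esub> = (\<lambda>k. int m mod int p ^ k)"
proof (induction m)
  case 0
  then show ?case by (simp add: add_pow_def nat_pow_def padic_int_simps)
next
  case (Suc m)
  then show ?case
    by (simp add: add_pow_def padic_int_simps mod_simps add_ac)
qed

lemma padic_mod_p_eq_0_iff:
  assumes "p > 0" and x: "x \<in> carrier (padic_int p)"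
  shows "padic_mod_p x = 0 \<longleftrightarrow>
    (\<exists>y\<in>carrier (padic_int p). x = (add_pow (padic_int p) p \<one>\<^bsub>padic_int p\<^esub>) \<otimes>\<^bsub>padic_int p\<^esub> y)"
proof
  assume "\<exists>y\<in>carrier (padic_int p). x = (add_pow (padic_int p) p \<one>\<^bsub>padic_int p\<^esub>) \<otimes>\<^bsub>padic_int p\<^esub> y"
  then show "padic_mod_p x = 0"
    by (auto simp: padic_nat_pow_one[OF assms(1)] padic_int_simps(2) padic_mod_p_def)
next
  assume "padic_mod_p x = 0"
  then have x1: "x (Suc 0) = 0" by (simp add: padic_mod_p_def)
  have dvd: "int p dvd x (Suc k)" for k
  proof (induction k)
    case (Suc k)
    have "int p dvd int p ^ Suc k" by simp
    then have "[x (Suc (Suc k)) = x (Suc k)] (mod int p)"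
      using padic_cong[OF x, of "Suc k"] cong_dvd_modulus by blast
    then show ?case using Suc cong_dvd_iff by blast
  qed (simp add: x1)
  define y where "y k = x (Suc k) div int p" for k
  have xy: "x (Suc k) = int p * y k" for k
    using dvd by (simp add: y_def)
  have "y k \<in> {0..<int p ^ k}" for k
  proof -
    have "0 \<le> int p * y k" "int p * y k < int p * int p ^ k"
      unfolding xy[symmetric] power_Suc[symmetric]
      using x unfolding padic_int_simps(1) by (meson atLeastLessThan_iff)+
    then show ?thesis using assms(1) by (simp add: zero_le_mult_iff)
  qed
  moreover have "y (Suc k) mod int p ^ k = y k" for k
  proof -
    have "(int p * y (Suc k)) mod (int p * int p ^ k) = int p * y k"
      using x by (simp add: padic_int_simps(1) xy[symmetric] flip: power_Suc)
    then show ?thesis using assms(1) by (simp flip: mult_mod_right)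
  qed
  ultimately have y: "y \<in> carrier (padic_int p)" by (simp add: padic_int_simps)
  have "x k = (int p * y k) mod int p ^ k" for k
    using x by (simp add: xy[symmetric] padic_int_simps(1))
  then have "x = (add_pow (padic_int p) p \<one>\<^bsub>padic_int p\<^esub>) \<otimes>\<^bsub>padic_int p\<^esub> y"
    by (simp add: padic_nat_pow_one[OF assms(1)] padic_int_simps(2) mod_simps fun_eq_iff)
  with y show "\<exists>y\<in>carrier (padic_int p). x = (add_pow (padic_int p) p \<one>\<^bsub>padic_int p\<^esub>) \<otimes>\<^bsub>padic_int p\<^esub> y"
    by blast
qed

end

theory Submission
  imports Defs
begin

text \<open>The roots of $f(pX)$ correspond to the roots of $f$ that are divisible by $p$.  Let $k$ be the
  index of the first coefficient of $f$ that is a unit; it exists and is at most $n$ because $f$ is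
  monic.  Modulo $p$ the polynomial $f$ is divisible by $X^k$ but not by $X^{k+1}$, and splitting off
  a linear factor $X - b$ with $p \mid b$ lowers this exponent by one, so $f$ has at most $k$ roots
  divisible by $p$ (a case of Strassmann's theorem).  Now $k \ge j$ means that the first $j$
  coefficients all vanish modulo $p$.  With $q$ the probability that $\xi_0$ vanishes modulo $p$,
  independence and equality of distributions give this event the probability $q^j$ for $j \le n$.
  Summing over $j$ bounds the expectation by $q + q^2 + \dots + q^n \le q/(1-q)$, where $q < 1$ because
  the residues are not almost surely constant.

  The factorisation is carried out in the integers, on residues modulo one high power of $p$, in
  \<open>card_approximate_roots_le\<close>: there the exponent of the modulus drops with every factor
  that is removed, which replaces cancellation in the domain of $p$-adic integers.  The link between
  the two worlds is \<open>eval_scaled_monic_poly\<close>.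

  That the number of roots is a random variable at all needs an argument too.  The condition that some
  root lies in a given residue class involves an uncountable existential quantifier.  By compactness
  (\<open>root_in_residue_class_iff\<close>) it is equivalent to countably many solvability
  conditions, each about finitely many residues.  The number of residue classes modulo $p^k$ that
  contain a root is therefore measurable, and it converges to the number of roots as $k$ grows.\<close>

section \<open>Truncations of $p$-adic integers\<close>

lemma padic_range:
  assumes "x \<in> carrier (padic_int p)"
  shows "0 \<le> x k" "x k < int p ^ k"
  using assms by (auto simp: padic_int_simps)

lemma padic_mod_level:
  assumes x: "x \<in> carrier (padic_int p)" and "j \<le> k"
  shows "x k mod int p ^ j = x j"
  using \<open>j \<le> k\<close>
proof (induction k rule: dec_induct)
  case base
  show ?case using x by (rule padic_mod_self)
next
  case (step k)
  have "int p ^ j dvd int p ^ k" using step.hyps by (simp add: le_imp_power_dvd)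
  then have "x (Suc k) mod int p ^ j = (x (Suc k) mod int p ^ k) mod int p ^ j"
    by (simp add: mod_mod_cancel)
  also have "\<dots> = x k mod int p ^ j" using x by (simp add: padic_int_simps)
  finally show ?case using step.IH by simp
qed

text \<open>Finitely many $p$-adic integers can be told apart by their residues modulo one power of $p$.  This
  serves both to transfer the root bound from integers and to obtain the number of roots as a limit.\<close>

lemma padic_eventually_inj:
  assumes "finite G" and G: "G \<subseteq> carrier (padic_int p)"
  shows "\<forall>\<^sub>F k in sequentially. inj_on (\<lambda>x. x k) G"
proof -
  have "\<forall>\<^sub>F k in sequentially. x k = y k \<longrightarrow> x = y" if "x \<in> G" "y \<in> G" for x y
  proof (cases "x = y")
    case False
    then obtain m where m: "x m \<noteq> y m" by auto
    have "x k \<noteq> y k" if "m \<le> k" for k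
      using m padic_mod_level[of x p m k] padic_mod_level[of y p m k]
        subsetD[OF G \<open>x \<in> G\<close>] subsetD[OF G \<open>y \<in> G\<close>] \<open>m \<le> k\<close> by auto
    then show ?thesis unfolding eventually_sequentially by blast
  qed auto
  then have "\<forall>\<^sub>F k in sequentially. \<forall>x\<in>G. \<forall>y\<in>G. x k = y k \<longrightarrow> x = y"
    by (intro eventually_ball_finite \<open>finite G\<close> ballI)
  then show ?thesis by (simp add: inj_on_def)
qed

text \<open>The compactness of the $p$-adic integers in the form of Koenig's lemma: residues satisfying \<open>P\<close>
  form a finitely branching tree, whose infinite branches are $p$-adic integers.\<close>

lemma padic_compactness:
  fixes P :: "nat \<Rightarrow> int \<Rightarrow> bool"
  assumes "p > 0"
    and down: "\<And>j y. P (Suc j) y \<Longrightarrow> P j (y mod int p ^ j)"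
    and solvable: "\<And>j. \<exists>y\<in>{0..<int p ^ j}. P j y"
  shows "\<exists>x\<in>carrier (padic_int p). \<forall>j. P j (x j)"
proof -
  have down_le: "P j (y mod int p ^ j)" if "j \<le> m" "P m y" "y \<in> {0..<int p ^ m}" for j m y
    using \<open>j \<le> m\<close>
  proof (induction j rule: inc_induct)
    case base
    show ?case using that by simp
  next
    case (step j)
    have "int p ^ j dvd int p ^ Suc j" by simp
    then show ?case using down[OF step.IH] by (simp only: mod_mod_cancel)
  qed
  \<comment> \<open>the residues that have descendants on every higher level\<close>
  define good where "good j y \<longleftrightarrow> y \<in> {0..<int p ^ j} \<and>
    (\<forall>m\<ge>j. \<exists>z\<in>{0..<int p ^ m}. P m z \<and> z mod int p ^ j = y)" for j y
  have "\<exists>x. \<forall>j. good j (x j) \<and> x (Suc j) mod int p ^ j = x j"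
  proof (rule dependent_nat_choice)
    show "\<exists>y. good 0 y"
      using solvable by (auto simp: good_def)
  next
    fix y j assume y: "good j y"
    show "\<exists>y'. good (Suc j) y' \<and> y' mod int p ^ j = y"
    proof (rule ccontr)
      assume neg: "\<not> ?thesis"
      define C where "C = {y' \<in> {0..<int p ^ Suc j}. y' mod int p ^ j = y}"
      have "\<forall>y'\<in>C. \<exists>m\<ge>Suc j. \<forall>z\<in>{0..<int p ^ m}. \<not> (P m z \<and> z mod int p ^ Suc j = y')"
        using neg unfolding C_def good_def by blast
      then obtain m where m: "\<And>y'. y' \<in> C \<Longrightarrow> m y' \<ge> Suc j"
        and no: "\<And>y' z. y' \<in> C \<Longrightarrow> z \<in> {0..<int p ^ m y'} \<Longrightarrow>
          \<not> (P (m y') z \<and> z mod int p ^ Suc j = y')"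
        by metis
      have "finite C"
        unfolding C_def by (rule finite_subset[of _ "{0..<int p ^ Suc j}"]) auto
      \<comment> \<open>each of the finitely many lifts of \<open>y\<close> dies out at some level, so all are dead at level \<open>N\<close>\<close>
      define N where "N = Max (insert (Suc j) (m ` C))"
      have N: "Suc j \<le> N" "\<And>y'. y' \<in> C \<Longrightarrow> m y' \<le> N"
        using \<open>finite C\<close> by (auto simp: N_def)
      from y N(1) obtain z where z: "z \<in> {0..<int p ^ N}" "P N z" "z mod int p ^ j = y"
        unfolding good_def by (meson Suc_leD)
      define y' where "y' = z mod int p ^ Suc j"
      have "int p ^ j dvd int p ^ Suc j" by simp
      then have "y' mod int p ^ j = y"
        unfolding y'_def using z(3) by (simp only: mod_mod_cancel)
      then have "y' \<in> C"
        using \<open>p > 0\<close> by (simp add: C_def y'_def del: power_Suc)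
      have "int p ^ Suc j dvd int p ^ m y'"
        by (rule le_imp_power_dvd) (rule m[OF \<open>y' \<in> C\<close>])
      then have "z mod int p ^ m y' mod int p ^ Suc j = y'"
        unfolding y'_def by (simp only: mod_mod_cancel)
      moreover have "P (m y') (z mod int p ^ m y')"
        using down_le N(2)[OF \<open>y' \<in> C\<close>] z by blast
      moreover have "z mod int p ^ m y' \<in> {0..<int p ^ m y'}" using \<open>p > 0\<close> by simp
      ultimately show False using no[OF \<open>y' \<in> C\<close>] by blast
    qed
  qed
  then obtain x where x: "\<And>j. good j (x j)" "\<And>j. x (Suc j) mod int p ^ j = x j" by blast
  have "x \<in> carrier (padic_int p)"
    using x by (auto simp: padic_int_simps good_def)
  moreover have "P j (x j)" for j
  proof -
    obtain z where "z \<in> {0..<int p ^ j}" "P j z" "z mod int p ^ j = x j"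
      using x(1)[of j] unfolding good_def by blast
    then show ?thesis by simp
  qed
  ultimately show ?thesis by blast
qed

section \<open>Roots of $f(pX)$ as compatible congruences\<close>

text \<open>An integer polynomial that represents the monic polynomial with $p$-adic coefficients \<open>a\<close>
  modulo $p^k$.\<close>

definition trunc_poly :: "nat \<Rightarrow> (nat \<Rightarrow> nat \<Rightarrow> int) \<Rightarrow> nat \<Rightarrow> int poly" where
  "trunc_poly n a k = (\<Sum>i<n. Polynomial.monom (a i k) i) + Polynomial.monom 1 n"

lemma coeff_trunc_poly:
  "Polynomial.coeff (trunc_poly n a k) i = (if i < n then a i k else if i = n then 1 else 0)"
  by (simp add: trunc_poly_def coeff_sum)

lemma poly_trunc_poly: "poly (trunc_poly n a k) z = (\<Sum>i<n. a i k * z ^ i) + z ^ n"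
  by (simp add: trunc_poly_def poly_sum poly_monom)

lemma padic_nat_pow:
  "x [^]\<^bsub>padic_int p\<^esub> (i::nat) = (\<lambda>k. x k ^ i mod int p ^ k)"
proof (induction i)
  case (Suc i)
  then show ?case by (simp add: padic_int_simps(2) mod_mult_left_eq power_Suc2 del: power_Suc)
qed (simp add: padic_int_simps(4))

lemma padic_finsum:
  fixes n :: nat
  assumes "p > 0" and "\<And>i. i < n \<Longrightarrow> g i \<in> carrier (padic_int p)"
  shows "finsum (padic_int p) g {..<n} = (\<lambda>k. (\<Sum>i<n. g i k) mod int p ^ k)"
proof -
  interpret R: cring "padic_int p" by (rule cring_padic_int[OF assms(1)])
  show ?thesis
    using assms(2)
  proof (induction n)
    case 0
    then show ?case by (simp add: padic_int_simps)
  next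
    case (Suc n)
    have "finsum (padic_int p) g {..<Suc n} = g n \<oplus>\<^bsub>padic_int p\<^esub> finsum (padic_int p) g {..<n}"
      unfolding lessThan_Suc using Suc.prems by (intro R.finsum_insert) auto
    then show ?case using Suc by (simp add: padic_int_simps(3) mod_simps add.commute)
  qed
qed

text \<open>Both the substitution $X \mapsto pX$ and the evaluation at \<open>x\<close> are ring homomorphisms, so it
  suffices to follow the monomials.\<close>

lemma eval_scaled_monic_poly:
  assumes p: "p > 0" and a: "\<And>i. i < n \<Longrightarrow> a i \<in> carrier (padic_int p)"
    and x: "x \<in> carrier (padic_int p)"
  shows "eval (padic_int p) (padic_int p) id x
      (poly_subst (padic_int p) (monic_poly (padic_int p) n a)
        (monom (UP (padic_int p)) (add_pow (padic_int p) p \<one>\<^bsub>padic_int p\<^esub>) 1))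
    = (\<lambda>k. poly (trunc_poly n a k) (int p * x k) mod int p ^ k)"
proof -
  define R where "R = padic_int p"
  define P where "P = UP R"
  define c where "c = add_pow R p \<one>\<^bsub>R\<^esub>"
  define g where "g = monom P c 1"
  interpret R: cring R unfolding R_def by (rule cring_padic_int[OF p])
  interpret UP_cring R P by unfold_locales (simp_all add: P_def)
  have c: "c \<in> carrier R" by (simp add: c_def)
  then have g: "g \<in> carrier P" by (simp add: g_def)
  have aR: "a \<in> {..<n} \<rightarrow> carrier R" using a by (auto simp: R_def)
  have xR: "x \<in> carrier R" using x by (simp add: R_def)
  interpret const: ring_hom_cring R P "\<lambda>r. monom P r 0"
    by unfold_locales (auto intro!: ring_hom_memI simp: monom_mult[symmetric] simp del: monom_mult)
  interpret subst: UP_pre_univ_prop R P "\<lambda>r. monom P r 0" P by unfold_locales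
  interpret subst_hom: ring_hom_cring P P "eval R P (\<lambda>r. monom P r 0) g"
    by (intro ring_hom_cringI subst.eval_ring_hom g P.cring_axioms)
  interpret idh: ring_hom_cring R R id
    by unfold_locales (auto intro!: ring_hom_memI)
  interpret ev: UP_pre_univ_prop R R id P by unfold_locales
  interpret ev_hom: ring_hom_cring P R "eval R R id x"
    by (intro ring_hom_cringI ev.eval_ring_hom xR P.cring_axioms R.cring_axioms)
  have E: "eval R R id x (eval R P (\<lambda>r. monom P r 0) g (monom P r i))
      = r \<otimes>\<^bsub>R\<^esub> (c \<otimes>\<^bsub>R\<^esub> x) [^]\<^bsub>R\<^esub> i" if r: "r \<in> carrier R" for r i
  proof -
    have gx: "eval R R id x g = c \<otimes>\<^bsub>R\<^esub> x"
      unfolding g_def using ev.eval_monom[OF c xR, of 1] xR by simp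
    have "eval R P (\<lambda>r. monom P r 0) g (monom P r i) = monom P r 0 \<otimes>\<^bsub>P\<^esub> g [^]\<^bsub>P\<^esub> i"
      using r g by (rule subst.eval_monom)
    then show ?thesis
      using r g gx ev.eval_const[OF xR r] by simp
  qed
  have m: "(\<lambda>i. monom P (a i) i) \<in> {..<n} \<rightarrow> carrier P" using aR by (auto simp: Pi_iff)
  have m': "(\<lambda>i. eval R P (\<lambda>r. monom P r 0) g (monom P (a i) i)) \<in> {..<n} \<rightarrow> carrier P"
    using m by (auto simp: Pi_iff)
  have "eval R R id x (poly_subst R (monic_poly R n a) g)
      = (\<Oplus>\<^bsub>R\<^esub>i\<in>{..<n}. eval R R id x (eval R P (\<lambda>r. monom P r 0) g (monom P (a i) i)))
        \<oplus>\<^bsub>R\<^esub> eval R R id x (eval R P (\<lambda>r. monom P r 0) g (monom P \<one>\<^bsub>R\<^esub> n))"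
    unfolding poly_subst_def monic_poly_def P_def[symmetric]
    using m m' by (simp add: o_def)
  also have "\<dots> = (\<Oplus>\<^bsub>R\<^esub>i\<in>{..<n}. a i \<otimes>\<^bsub>R\<^esub> (c \<otimes>\<^bsub>R\<^esub> x) [^]\<^bsub>R\<^esub> i) \<oplus>\<^bsub>R\<^esub> (c \<otimes>\<^bsub>R\<^esub> x) [^]\<^bsub>R\<^esub> n"
  proof -
    have "(\<Oplus>\<^bsub>R\<^esub>i\<in>{..<n}. eval R R id x (eval R P (\<lambda>r. monom P r 0) g (monom P (a i) i)))
        = (\<Oplus>\<^bsub>R\<^esub>i\<in>{..<n}. a i \<otimes>\<^bsub>R\<^esub> (c \<otimes>\<^bsub>R\<^esub> x) [^]\<^bsub>R\<^esub> i)"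
      using aR c xR by (intro R.finsum_cong') (auto simp: E Pi_iff)
    then show ?thesis using E[of "\<one>\<^bsub>R\<^esub>" n] c xR by simp
  qed
  also have "\<dots> = (\<lambda>k. poly (trunc_poly n a k) (int p * x k) mod int p ^ k)"
  proof -
    have "a i \<otimes>\<^bsub>R\<^esub> (c \<otimes>\<^bsub>R\<^esub> x) [^]\<^bsub>R\<^esub> i \<in> carrier (padic_int p)" if "i < n" for i
      unfolding R_def[symmetric] using aR c xR that by auto
    then have sum: "(\<Oplus>\<^bsub>R\<^esub>i\<in>{..<n}. a i \<otimes>\<^bsub>R\<^esub> (c \<otimes>\<^bsub>R\<^esub> x) [^]\<^bsub>R\<^esub> i)
        = (\<lambda>k. (\<Sum>i<n. (a i \<otimes>\<^bsub>R\<^esub> (c \<otimes>\<^bsub>R\<^esub> x) [^]\<^bsub>R\<^esub> i) k) mod int p ^ k)"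
      unfolding R_def by (rule padic_finsum[OF p])
    have cx: "c \<otimes>\<^bsub>R\<^esub> x = (\<lambda>k. int p * x k mod int p ^ k)"
      by (simp add: c_def R_def padic_nat_pow_one[OF p] padic_int_simps(2) mod_mult_left_eq)
    have pow: "(c \<otimes>\<^bsub>R\<^esub> x) [^]\<^bsub>R\<^esub> i = (\<lambda>k. (int p * x k) ^ i mod int p ^ k)" for i :: nat
      unfolding cx unfolding R_def padic_nat_pow by (simp add: power_mod)
    have summand: "a i \<otimes>\<^bsub>R\<^esub> (c \<otimes>\<^bsub>R\<^esub> x) [^]\<^bsub>R\<^esub> i = (\<lambda>k. a i k * (int p * x k) ^ i mod int p ^ k)" for i
      unfolding pow unfolding R_def padic_int_simps(2) by (simp add: mod_mult_right_eq)
    show ?thesis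
      unfolding sum unfolding summand unfolding pow unfolding R_def padic_int_simps(3)
      by (simp add: poly_trunc_poly mod_sum_eq mod_add_eq)
  qed
  finally show ?thesis unfolding R_def P_def g_def c_def .
qed

definition root_set :: "nat \<Rightarrow> nat \<Rightarrow> (nat \<Rightarrow> nat \<Rightarrow> int) \<Rightarrow> (nat \<Rightarrow> int) set" where
  "root_set p n a = {x \<in> carrier (padic_int p).
     \<forall>k. int p ^ k dvd poly (trunc_poly n a k) (int p * x k)}"

lemma padic_root_count_eq:
  assumes "p > 0" and "\<And>i. i < n \<Longrightarrow> a i \<in> carrier (padic_int p)"
  shows "padic_root_count p (poly_subst (padic_int p) (monic_poly (padic_int p) n a)
        (monom (UP (padic_int p)) (add_pow (padic_int p) p \<one>\<^bsub>padic_int p\<^esub>) 1))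
    = card (root_set p n a)"
proof -
  have "{x \<in> carrier (padic_int p). eval (padic_int p) (padic_int p) id x
      (poly_subst (padic_int p) (monic_poly (padic_int p) n a)
        (monom (UP (padic_int p)) (add_pow (padic_int p) p \<one>\<^bsub>padic_int p\<^esub>) 1))
      = \<zero>\<^bsub>padic_int p\<^esub>} = root_set p n a"
    unfolding root_set_def using eval_scaled_monic_poly[OF assms]
    by (auto simp: padic_int_simps(5) fun_eq_iff dvd_eq_mod_eq_0)
  then show ?thesis unfolding padic_root_count_def by simp
qed

section \<open>Bounding the number of roots\<close>

text \<open>Induction on \<open>k\<close>, removing one root \<open>b\<close>.  In $f = (X - b) h + f(b)$ the coefficients of
  \<open>h\<close> are those of \<open>f\<close> shifted by one, modulo \<open>q\<close>, because \<open>q\<close> divides \<open>b\<close>.  Any other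
  approximate root \<open>b'\<close> satisfies $q^K \mid (b' - b) h(b')$, and fewer than \<open>m\<close> of these factors
  can be absorbed by $b' - b$.  So \<open>b'\<close> is a root of \<open>h\<close> modulo $q^{K-m}$, and the hypothesis
  \<open>k * m < K\<close> leaves a positive exponent when \<open>k\<close> reaches zero.\<close>

lemma card_approximate_roots_le:
  fixes f :: "int poly" and q :: int
  assumes "prime q" and "finite B"
    and "\<And>b. b \<in> B \<Longrightarrow> q dvd b"
    and "\<And>b b'. b \<in> B \<Longrightarrow> b' \<in> B \<Longrightarrow> b \<noteq> b' \<Longrightarrow> \<not> q ^ m dvd b - b'"
    and "\<And>b. b \<in> B \<Longrightarrow> q ^ K dvd poly f b"
    and "k * m < K"
    and "\<And>i. i < k \<Longrightarrow> q dvd Polynomial.coeff f i"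
    and "\<not> q dvd Polynomial.coeff f k"
  shows "card B \<le> k"
  using assms(2-)
proof (induction k arbitrary: f B K)
  case 0
  have "B = {}"
  proof (rule ccontr)
    assume "B \<noteq> {}"
    then obtain b where b: "b \<in> B" by blast
    have "q dvd q ^ K" using \<open>0 * m < K\<close> by (simp add: dvd_power)
    then have "q dvd poly f b" using 0(4)[OF b] dvd_trans by blast
    moreover have "f = pCons (Polynomial.coeff f 0) (poly_shift 1 f)"
      by (rule poly_eqI) (simp add: coeff_pCons coeff_poly_shift split: nat.split)
    then have "poly f b = Polynomial.coeff f 0 + b * poly (poly_shift 1 f) b"
      by (metis poly_pCons)
    ultimately have "q dvd Polynomial.coeff f 0"
      using 0(2)[OF b] by (simp add: dvd_add_left_iff)
    then show False using 0 by simp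
  qed
  then show ?case by simp
next
  case (Suc k)
  show ?case
  proof (cases "B = {}")
    case False
    then obtain b where b: "b \<in> B" by blast
    define h where "h = synthetic_div f b"
    have f: "f = [:- b, 1:] * h + [:poly f b:]"
      unfolding h_def by (rule synthetic_div_correct'[symmetric])
    have fc: "Polynomial.coeff f (Suc i) = Polynomial.coeff h i - b * Polynomial.coeff h (Suc i)" for i
      by (subst f) (simp add: coeff_pCons)
    then have hc: "q dvd Polynomial.coeff h i \<longleftrightarrow> q dvd Polynomial.coeff f (Suc i)" for i
      using Suc.prems(2)[OF b] by (simp add: dvd_diff_left_iff)
    have fv: "poly f z = (z - b) * poly h z + poly f b" for z
      by (subst f) (simp add: algebra_simps)
    have "card (B - {b}) \<le> k"
    proof (rule Suc.IH)
      fix b' assume b': "b' \<in> B - {b}"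
      have "q ^ K dvd (b' - b) * poly h b'"
        using Suc.prems(4)[OF b] Suc.prems(4)[of b'] b' fv[of b'] by (simp add: dvd_add_left_iff)
      then obtain r s where rs: "r + s = K" "q ^ r dvd b' - b" "q ^ s dvd poly h b'"
        using prime_elem_power_dvd_prod \<open>prime q\<close> by (metis prime_imp_prime_elem)
      have "r < m"
        using Suc.prems(3)[of b' b] b b' rs(2) power_le_dvd[of q r "b' - b" m]
        by (auto simp: not_less[symmetric])
      then have "K - m \<le> s" using rs(1) by simp
      then show "q ^ (K - m) dvd poly h b'" using rs(3) power_le_dvd by blast
    next
      show "k * m < K - m" using Suc.prems(5) by simp
    qed (use Suc.prems hc in auto)
    then show ?thesis using Suc.prems(1) b by simp
  qed simp
qed

lemma card_root_set_le:
  assumes "prime p" and a: "\<And>i. i < n \<Longrightarrow> a i \<in> carrier (padic_int p)"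
    and "k \<le> n" and lo: "\<And>i. i < k \<Longrightarrow> a i 1 = 0" and hi: "k < n \<Longrightarrow> a k 1 \<noteq> 0"
  shows "finite (root_set p n a) \<and> card (root_set p n a) \<le> k"
proof (rule finite_if_finite_subsets_card_bdd)
  fix G assume G: "G \<subseteq> root_set p n a" "finite G"
  have "p > 0" using \<open>prime p\<close> prime_gt_0_nat by blast
  have GC: "x \<in> carrier (padic_int p)" if "x \<in> G" for x
    using that G by (auto simp: root_set_def)
  obtain m where m: "\<And>l. l \<ge> m \<Longrightarrow> inj_on (\<lambda>x. x l) G"
    using padic_eventually_inj[of G p] G(2) GC by (auto simp: eventually_sequentially)
  \<comment> \<open>Multiplication by \<open>p\<close> raises the separating exponent from \<open>m\<close> to \<open>Suc m\<close>; \<open>K\<close> must exceed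
      \<open>k * Suc m\<close> for the root bound and be at least \<open>m\<close> to keep the roots distinct.\<close>
  define K where "K = Suc (k * Suc m + m)"
  have "m \<le> K" "1 \<le> K" by (simp_all add: K_def)
  have inj: "inj_on (\<lambda>x. int p * x K) G"
    using m[OF \<open>m \<le> K\<close>] \<open>p > 0\<close> by (auto simp: inj_on_def)
  have coeff: "int p dvd a i K \<longleftrightarrow> a i 1 = 0" if "i < n" for i
    using padic_mod_level[OF a[OF that] \<open>1 \<le> K\<close>] by (simp add: dvd_eq_mod_eq_0)
  have "card ((\<lambda>x. int p * x K) ` G) \<le> k"
  proof (rule card_approximate_roots_le[where q = "int p" and m = "Suc m" and K = K
        and f = "trunc_poly n a K"])
    fix b b' assume "b \<in> (\<lambda>x. int p * x K) ` G" "b' \<in> (\<lambda>x. int p * x K) ` G" "b \<noteq> b'"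
    then obtain x y where xy: "x \<in> G" "y \<in> G" "x \<noteq> y" "b = int p * x K" "b' = int p * y K" by auto
    show "\<not> int p ^ Suc m dvd b - b'"
    proof
      assume "int p ^ Suc m dvd b - b'"
      then have "int p ^ m dvd x K - y K"
        using \<open>p > 0\<close> by (simp add: xy flip: right_diff_distrib)
      then have "x K mod int p ^ m = y K mod int p ^ m" by (simp add: mod_eq_dvd_iff)
      then have "x m = y m" using padic_mod_level[OF GC \<open>m \<le> K\<close>] xy by simp
      then show False using m[of m] xy by (auto simp: inj_on_def)
    qed
  next
    show "int p ^ K dvd poly (trunc_poly n a K) b" if "b \<in> (\<lambda>x. int p * x K) ` G" for b
      using that G by (auto simp: root_set_def)
  next
    show "int p dvd Polynomial.coeff (trunc_poly n a K) i" if "i < k" for i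
      using that \<open>k \<le> n\<close> coeff lo by (simp add: coeff_trunc_poly)
  next
    show "\<not> int p dvd Polynomial.coeff (trunc_poly n a K) k"
      using \<open>k \<le> n\<close> coeff hi \<open>prime p\<close> by (auto simp: coeff_trunc_poly)
  next
    show "k * Suc m < K" by (simp add: K_def)
  qed (use \<open>prime p\<close> G in auto)
  then show "card G \<le> k" using card_image[OF inj] by simp
qed

text \<open>The sum is the index of the first unit coefficient, written as a sum of indicators so that its
  expectation can be taken termwise.\<close>

lemma card_root_set_le_sum:
  assumes "prime p" and "\<And>i. i < n \<Longrightarrow> a i \<in> carrier (padic_int p)"
  shows "finite (root_set p n a)"
    and "card (root_set p n a) \<le> (\<Sum>j=1..n. of_bool (\<forall>i<j. a i 1 = 0))"
proof -
  define k where "k = (LEAST i. i = n \<or> a i 1 \<noteq> 0)"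
  have k: "k = n \<or> a k 1 \<noteq> 0"
    unfolding k_def by (rule LeastI[of _ n]) simp
  have "k \<le> n" unfolding k_def by (rule Least_le) simp
  have below: "a i 1 = 0" if "i < k" for i
    using not_less_Least[of i] that unfolding k_def by blast
  have *: "finite (root_set p n a) \<and> card (root_set p n a) \<le> k"
    by (rule card_root_set_le) (use assms k \<open>k \<le> n\<close> below in auto)
  then show "finite (root_set p n a)" by blast
  have "k = (\<Sum>j=1..k. of_bool (\<forall>i<j. a i 1 = 0))" using below by simp
  also have "\<dots> \<le> (\<Sum>j=1..n. of_bool (\<forall>i<j. a i 1 = 0))"
    using \<open>k \<le> n\<close> by (intro sum_mono2) auto
  finally show "card (root_set p n a) \<le> (\<Sum>j=1..n. of_bool (\<forall>i<j. a i 1 = 0))"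
    using * by linarith
qed

section \<open>Measurability of the number of roots\<close>

text \<open>For \<open>j < k\<close> the residue modulo $p^j$ does not determine the class modulo $p^k$, hence the guard
  \<open>k \<le> j\<close>, which makes the conditions stable under reduction to lower levels.\<close>

lemma root_in_residue_class_iff:
  assumes "p > 0" and a: "\<And>i. i < n \<Longrightarrow> a i \<in> carrier (padic_int p)"
  shows "(\<exists>x\<in>root_set p n a. x k = r) \<longleftrightarrow>
    (\<forall>j. \<exists>y\<in>{0..<int p ^ j}. (k \<le> j \<longrightarrow> y mod int p ^ k = r) \<and>
       int p ^ j dvd poly (trunc_poly n a j) (int p * y))" (is "_ \<longleftrightarrow> (\<forall>j. \<exists>y\<in>_. ?P j y)")
proof
  assume "\<exists>x\<in>root_set p n a. x k = r"
  then obtain x where x: "x \<in> root_set p n a" "x k = r" by blast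
  then have xc: "x \<in> carrier (padic_int p)" by (simp add: root_set_def)
  show "\<forall>j. \<exists>y\<in>{0..<int p ^ j}. ?P j y"
    using x padic_mod_level[OF xc] padic_range[OF xc] by (intro allI bexI[of _ "x _"]) (auto simp: root_set_def)
next
  assume solvable: "\<forall>j. \<exists>y\<in>{0..<int p ^ j}. ?P j y"
  have "\<exists>x\<in>carrier (padic_int p). \<forall>j. ?P j (x j)"
  proof (rule padic_compactness[OF \<open>p > 0\<close>])
    fix j y assume P: "?P (Suc j) y"
    have "[a i (Suc j) = a i j] (mod int p ^ j)" if "i < n" for i
      using padic_cong[OF a[OF that]] .
    then have "[poly (trunc_poly n a (Suc j)) (int p * y)
        = poly (trunc_poly n a j) (int p * (y mod int p ^ j))] (mod int p ^ j)"
      unfolding poly_trunc_poly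
      by (intro cong_add cong_sum cong_mult cong_pow cong_refl) (auto simp: cong_def)
    moreover have "int p ^ j dvd poly (trunc_poly n a (Suc j)) (int p * y)"
      using P by (meson dvd_trans le_imp_power_dvd lessI less_imp_le)
    ultimately have "int p ^ j dvd poly (trunc_poly n a j) (int p * (y mod int p ^ j))"
      using cong_dvd_iff by blast
    moreover have "y mod int p ^ j mod int p ^ k = r" if "k \<le> j"
      using P that by (simp add: mod_mod_cancel le_imp_power_dvd)
    ultimately show "?P j (y mod int p ^ j)" by blast
  qed (use solvable in blast)
  then obtain x where x: "x \<in> carrier (padic_int p)" "\<And>j. ?P j (x j)" by blast
  then have "x k = r" using padic_mod_self[OF x(1), of k] by auto
  with x show "\<exists>x\<in>root_set p n a. x k = r" by (auto simp: root_set_def)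
qed

lemma space_padic_borel: "space (padic_borel p) = carrier (padic_int p)"
  unfolding padic_borel_def padic_topology_def
  by (rule space_measure_of) (auto simp: openin_subtopology)

text \<open>Residue classes are open because the projections of the inverse limit are continuous.\<close>

lemma measurable_padic_coordinate:
  "(\<lambda>x. x k) \<in> measurable (padic_borel p) (count_space UNIV)"
proof -
  have "(\<lambda>x. x k) -` {r} \<inter> carrier (padic_int p) \<in> sets (padic_borel p)" for r
  proof -
    have "openin (product_topology (\<lambda>k. discrete_topology UNIV) UNIV)
        {x \<in> topspace (product_topology (\<lambda>k::nat. discrete_topology (UNIV::int set)) UNIV). x k \<in> {r}}"
      by (rule openin_continuous_map_preimage[OF continuous_map_product_projection]) auto
    then have "openin (padic_topology p) ((\<lambda>x. x k) -` {r} \<inter> carrier (padic_int p))"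
      unfolding padic_topology_def openin_subtopology by (intro exI conjI) (auto simp: vimage_def)
    moreover have "sets (padic_borel p) =
        sigma_sets (carrier (padic_int p)) {U. openin (padic_topology p) U}"
      unfolding padic_borel_def padic_topology_def
      by (rule sets_measure_of) (auto simp: openin_subtopology)
    ultimately show ?thesis by auto
  qed
  then show ?thesis
    by (subst measurable_count_space_eq2_countable) (auto simp: space_padic_borel)
qed

text \<open>For each \<open>k\<close> the number of residue classes modulo $p^k$ that contain a root is a finite sum of
  measurable indicators; once \<open>k\<close> separates the finitely many roots it equals their number.\<close>

lemma measurable_card_root_set:
  assumes "prime p"
    and X: "\<And>i. i < n \<Longrightarrow> X i \<in> measurable M (padic_borel p)"
  shows "(\<lambda>\<omega>. real (card (root_set p n (\<lambda>i. X i \<omega>)))) \<in> borel_measurable M"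
proof -
  have "p > 0" using \<open>prime p\<close> prime_gt_0_nat by blast
  have carr: "X i \<omega> \<in> carrier (padic_int p)" if "i < n" "\<omega> \<in> space M" for i \<omega>
    using measurable_space[OF X[OF that(1)] that(2)] by (simp add: space_padic_borel)
  have coord: "(\<lambda>\<omega>. X i \<omega> j) \<in> measurable M (count_space UNIV)" if "i < n" for i j
    using measurable_compose[OF X[OF that] measurable_padic_coordinate] .
  have poly_meas: "(\<lambda>\<omega>. poly (trunc_poly n (\<lambda>i. X i \<omega>) j) z) \<in> measurable M (count_space UNIV)" for j z
  proof -
    have "(\<lambda>\<omega>. \<Sum>i<l. X i \<omega> j * z ^ i) \<in> measurable M (count_space UNIV)" if "l \<le> n" for l
      using that
    proof (induction l)
      case (Suc l)
      have "(\<lambda>\<omega>. X l \<omega> j) \<in> measurable M (count_space UNIV)" using coord Suc.prems by simp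
      moreover have "(\<lambda>\<omega>. \<Sum>i<l. X i \<omega> j * z ^ i) \<in> measurable M (count_space UNIV)" using Suc by simp
      ultimately have "(\<lambda>\<omega>. (\<Sum>i<l. X i \<omega> j * z ^ i) + X l \<omega> j * z ^ l) \<in> measurable M (count_space UNIV)"
        by measurable
      then show ?case by simp
    qed simp
    from this[of n] have [measurable]:
      "(\<lambda>\<omega>. \<Sum>i<n. X i \<omega> j * z ^ i) \<in> measurable M (count_space UNIV)" by simp
    show ?thesis unfolding poly_trunc_poly by measurable
  qed
  define hit where "hit k r \<omega> \<longleftrightarrow> (\<exists>x\<in>root_set p n (\<lambda>i. X i \<omega>). x k = r)" for k r \<omega>
  have hit_meas [measurable]: "Measurable.pred M (hit k r)" for k r
  proof -
    let ?solvable = "\<lambda>\<omega>. \<forall>j. \<exists>y\<in>{0..<int p ^ j}. (k \<le> j \<longrightarrow> y mod int p ^ k = r) \<and>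
        int p ^ j dvd poly (trunc_poly n (\<lambda>i. X i \<omega>) j) (int p * y)"
    have "hit k r \<omega> \<longleftrightarrow> ?solvable \<omega>" if "\<omega> \<in> space M" for \<omega>
      unfolding hit_def by (rule root_in_residue_class_iff[OF \<open>p > 0\<close> carr[OF _ that]])
    then have "Measurable.pred M (hit k r) \<longleftrightarrow> Measurable.pred M ?solvable"
      by (rule measurable_cong)
    moreover have "Measurable.pred M ?solvable"
    proof (rule pred_intros_countable(1), rule pred_intros_countable_bounded(4), rule pred_intros_logic(3))
      show "Measurable.pred M (\<lambda>\<omega>. int p ^ j dvd poly (trunc_poly n (\<lambda>i. X i \<omega>) j) (int p * y))" for j y
        by (rule measurable_compose[OF poly_meas, where g = "\<lambda>v. int p ^ j dvd v"]) simp
    qed simp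
    ultimately show ?thesis by blast
  qed
  show ?thesis
  proof (rule borel_measurable_LIMSEQ_real)
    show "(\<lambda>\<omega>. \<Sum>r\<in>{0..<int p ^ k}. of_bool (hit k r \<omega>) :: real) \<in> borel_measurable M" for k
      by measurable
  next
    fix \<omega> assume "\<omega> \<in> space M"
    define Z where "Z = root_set p n (\<lambda>i. X i \<omega>)"
    have "finite Z"
      unfolding Z_def by (rule card_root_set_le_sum) (use assms carr \<open>\<omega> \<in> space M\<close> in auto)
    have ZC: "Z \<subseteq> carrier (padic_int p)" by (auto simp: Z_def root_set_def)
    have "(\<Sum>r\<in>{0..<int p ^ k}. of_bool (hit k r \<omega>) :: real) = real (card ((\<lambda>x. x k) ` Z))" for k
    proof -
      have "{r \<in> {0..<int p ^ k}. hit k r \<omega>} = (\<lambda>x. x k) ` Z"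
        using ZC padic_range by (fastforce simp: hit_def Z_def)
      moreover have "(\<Sum>r\<in>{0..<int p ^ k}. of_bool (hit k r \<omega>) :: real)
          = real (card {r \<in> {0..<int p ^ k}. hit k r \<omega>})"
        by (simp add: of_bool_def sum.If_cases Int_def)
      ultimately show ?thesis by simp
    qed
    moreover have "\<forall>\<^sub>F k in sequentially. real (card ((\<lambda>x. x k) ` Z)) = real (card Z)"
      using padic_eventually_inj[OF \<open>finite Z\<close> ZC] by eventually_elim (simp add: card_image)
    ultimately show "(\<lambda>k. \<Sum>r\<in>{0..<int p ^ k}. of_bool (hit k r \<omega>))
        \<longlonglongrightarrow> real (card (root_set p n (\<lambda>i. X i \<omega>)))"
      by (simp add: Z_def tendsto_eventually)
  qed
qed

section \<open>The expected number of roots\<close>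

lemma geometric_sum_le:
  fixes q :: real
  assumes "0 \<le> q" "q < 1"
  shows "(\<Sum>j=1..n. q ^ j) \<le> q / (1 - q)"
proof -
  have "(1 - q) * (\<Sum>j=1..n. q ^ j) = q * (1 - q ^ n)"
  proof (induction n)
    case (Suc n)
    have "(1 - q) * (\<Sum>j=1..Suc n. q ^ j) = (1 - q) * (\<Sum>j=1..n. q ^ j) + (1 - q) * q ^ Suc n"
      by (simp add: distrib_left)
    also have "\<dots> = q * (1 - q ^ Suc n)"
      unfolding Suc by (simp add: algebra_simps)
    finally show ?case .
  qed simp
  also have "\<dots> \<le> q" using assms by (simp add: algebra_simps)
  finally show ?thesis using assms by (simp add: field_simps)
qed

theorem mainTheorem5:
  fixes p n :: nat
    and M :: "'a measure"
    and \<xi> :: "nat \<Rightarrow> 'a \<Rightarrow> (nat \<Rightarrow> int)"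
    and f f\<^sub>0 :: "'a \<Rightarrow> nat \<Rightarrow> (nat \<Rightarrow> int)"
  defines "f \<equiv> (\<lambda>\<omega>. monic_poly (padic_int p) n (\<lambda>i. \<xi> i \<omega>))"
    and "f\<^sub>0 \<equiv> (\<lambda>\<omega>. poly_subst (padic_int p) (f \<omega>)
      (monom (UP (padic_int p)) (add_pow (padic_int p) p \<one>\<^bsub>padic_int p\<^esub>) 1))"
  assumes "prime p"
    and "n \<ge> 1"
    and "prob_space M"
    and "prob_space.indep_vars M (\<lambda>_. padic_borel p) \<xi> {..<n}"
    and "\<And>i j. i < n \<Longrightarrow> j < n \<Longrightarrow>
      distr M (padic_borel p) (\<xi> i) = distr M (padic_borel p) (\<xi> j)"
    and "\<And>i. i < n \<Longrightarrow> \<not> (\<exists>c. AE \<omega> in M. padic_mod_p (\<xi> i \<omega>) = c)"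
  shows "integrable M (\<lambda>\<omega>. real (padic_root_count p (f\<^sub>0 \<omega>))) \<and>
    prob_space.expectation M (\<lambda>\<omega>. real (padic_root_count p (f\<^sub>0 \<omega>)))
      \<le> \<P>(\<omega> in M. padic_mod_p (\<xi> 0 \<omega>) = 0) / \<P>(\<omega> in M. padic_mod_p (\<xi> 0 \<omega>) \<noteq> 0)"
proof -
  interpret prob_space M by fact
  have "p > 0" using \<open>prime p\<close> prime_gt_0_nat by blast
  have rv: "\<xi> i \<in> measurable M (padic_borel p)" if "i < n" for i
    using assms(6) that by (auto simp: indep_vars_def)
  have carr: "\<xi> i \<omega> \<in> carrier (padic_int p)" if "i < n" "\<omega> \<in> space M" for i \<omega>
    using measurable_space[OF rv[OF that(1)] that(2)] by (simp add: space_padic_borel)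
  define N where "N \<omega> = card (root_set p n (\<lambda>i. \<xi> i \<omega>))" for \<omega>
  have count: "padic_root_count p (f\<^sub>0 \<omega>) = N \<omega>" if "\<omega> \<in> space M" for \<omega>
    unfolding f\<^sub>0_def f_def N_def by (rule padic_root_count_eq[OF \<open>p > 0\<close> carr[OF _ that]])
  \<comment> \<open>the event that the first unit coefficient has index at least \<open>j\<close>\<close>
  define E where "E j = {\<omega> \<in> space M. \<forall>i<j. \<xi> i \<omega> 1 = 0}" for j
  have N_le: "real (N \<omega>) \<le> (\<Sum>j=1..n. indicator (E j) \<omega>)" if "\<omega> \<in> space M" for \<omega>
  proof -
    have "N \<omega> \<le> (\<Sum>j=1..n. of_bool (\<forall>i<j. \<xi> i \<omega> 1 = 0))"
      unfolding N_def by (rule card_root_set_le_sum(2)[OF \<open>prime p\<close> carr[OF _ that]])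
    then have "real (N \<omega>) \<le> real (\<Sum>j=1..n. of_bool (\<forall>i<j. \<xi> i \<omega> 1 = 0))" by (rule of_nat_mono)
    also have "\<dots> = (\<Sum>j=1..n. indicator (E j) \<omega>)"
      using that by (auto simp: E_def indicator_def intro!: sum.cong)
    finally show ?thesis .
  qed
  have N_meas: "(\<lambda>\<omega>. real (N \<omega>)) \<in> borel_measurable M"
    unfolding N_def using \<open>prime p\<close> rv by (rule measurable_card_root_set)

  define A where "A = (\<lambda>x::nat \<Rightarrow> int. x 1) -` {0} \<inter> space (padic_borel p)"
  have A: "A \<in> sets (padic_borel p)"
    unfolding A_def by (rule measurable_sets[OF measurable_padic_coordinate]) simp
  have A_iff: "\<xi> i -` A \<inter> space M = {\<omega> \<in> space M. \<xi> i \<omega> 1 = 0}" if "i < n" for i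
    using carr that by (auto simp: A_def space_padic_borel)
  define q where "q = prob {\<omega> \<in> space M. \<xi> 0 \<omega> 1 = 0}"
  have q_eq: "prob (\<xi> i -` A \<inter> space M) = q" if "i < n" for i
  proof -
    have "prob (\<xi> i -` A \<inter> space M) = measure (distr M (padic_borel p) (\<xi> i)) A"
      using rv[OF that] A by (simp add: measure_distr)
    also have "\<dots> = measure (distr M (padic_borel p) (\<xi> 0)) A"
      using assms(7)[of i 0] that by simp
    also have "\<dots> = prob (\<xi> 0 -` A \<inter> space M)"
      using rv[of 0] that A by (simp add: measure_distr)
    finally show ?thesis using A_iff[of 0] that by (simp add: q_def)
  qed
  have zero_ev: "{\<omega> \<in> space M. \<xi> 0 \<omega> 1 = 0} \<in> events"
    using measurable_sets[OF rv A, of 0] A_iff[of 0] \<open>n \<ge> 1\<close> by simp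

  have E: "E j \<in> events \<and> prob (E j) = q ^ j" if "j \<in> {1..n}" for j
  proof -
    have "E j = (\<Inter>i\<in>{..<j}. \<xi> i -` A \<inter> space M)"
    proof -
      have "E j = (\<Inter>i\<in>{..<j}. {\<omega> \<in> space M. \<xi> i \<omega> 1 = 0})"
      proof (intro equalityI subsetI)
        fix \<omega> assume \<omega>: "\<omega> \<in> (\<Inter>i\<in>{..<j}. {\<omega> \<in> space M. \<xi> i \<omega> 1 = 0})"
        have "0 \<in> {..<j}" using that by simp
        then have "\<omega> \<in> space M" using INT_D[OF \<omega>] by blast
        then show "\<omega> \<in> E j" using \<omega> by (simp add: E_def)
      qed (simp add: E_def)
      also have "\<dots> = (\<Inter>i\<in>{..<j}. \<xi> i -` A \<inter> space M)"
        using that by (intro INF_cong refl A_iff[symmetric]) auto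
      finally show ?thesis .
    qed
    moreover have "prob (\<Inter>i\<in>{..<j}. \<xi> i -` A \<inter> space M) = (\<Prod>i\<in>{..<j}. prob (\<xi> i -` A \<inter> space M))"
      using that A by (intro indep_varsD[OF assms(6)]) (auto simp: lessThan_empty_iff)
    moreover have "(\<Prod>i\<in>{..<j}. prob (\<xi> i -` A \<inter> space M)) = q ^ j"
      using that q_eq by simp
    moreover have "(\<Inter>i\<in>{..<j}. \<xi> i -` A \<inter> space M) \<in> events"
      using that A rv by (intro sets.finite_INT measurable_sets) (auto simp: lessThan_empty_iff)
    ultimately show ?thesis by simp
  qed

  have int_N: "integrable M (\<lambda>\<omega>. real (N \<omega>))"
  proof (rule integrable_const_bound[where B = "real n"])
    have "real (N \<omega>) \<le> real n" if "\<omega> \<in> space M" for \<omega>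
    proof -
      have "(\<Sum>j=1..n. indicator (E j) \<omega> :: real) \<le> (\<Sum>j=1..n. 1)"
        by (intro sum_mono) (auto simp: indicator_def)
      then show ?thesis using N_le[OF that] by simp
    qed
    then show "AE \<omega> in M. norm (real (N \<omega>)) \<le> real n" by simp
  qed (rule N_meas)
  have "q \<le> 1" "0 \<le> q" by (simp_all add: q_def)
  have "q \<noteq> 1"
  proof
    assume "q = 1"
    then have "AE \<omega> in M. \<omega> \<in> {\<omega> \<in> space M. \<xi> 0 \<omega> 1 = 0}"
      using prob_eq_1[OF zero_ev] by (simp add: q_def)
    then have "AE \<omega> in M. padic_mod_p (\<xi> 0 \<omega>) = 0"
      by eventually_elim (simp add: padic_mod_p_def)
    then show False using assms(8)[of 0] \<open>n \<ge> 1\<close> by auto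
  qed
  have "expectation (\<lambda>\<omega>. real (N \<omega>)) \<le> expectation (\<lambda>\<omega>. \<Sum>j=1..n. indicator (E j) \<omega>)"
    using E N_le by (intro integral_mono int_N Bochner_Integration.integrable_sum)
      (auto simp: emeasure_eq_measure)
  also have "\<dots> = (\<Sum>j=1..n. prob (E j))"
    using E by (subst Bochner_Integration.integral_sum) (auto simp: emeasure_eq_measure)
  also have "\<dots> = (\<Sum>j=1..n. q ^ j)" using E by simp
  also have "\<dots> \<le> q / (1 - q)"
    using \<open>0 \<le> q\<close> \<open>q \<le> 1\<close> \<open>q \<noteq> 1\<close> by (intro geometric_sum_le) auto
  also have "1 - q = \<P>(\<omega> in M. \<xi> 0 \<omega> 1 \<noteq> 0)"
    using prob_neg[of "\<lambda>\<omega>. \<xi> 0 \<omega> 1 = 0"] zero_ev by (simp add: q_def)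
  finally have "expectation (\<lambda>\<omega>. real (N \<omega>))
      \<le> \<P>(\<omega> in M. \<xi> 0 \<omega> 1 = 0) / \<P>(\<omega> in M. \<xi> 0 \<omega> 1 \<noteq> 0)"
    by (simp add: q_def)
  moreover have "expectation (\<lambda>\<omega>. real (padic_root_count p (f\<^sub>0 \<omega>))) = expectation (\<lambda>\<omega>. real (N \<omega>))"
    by (rule Bochner_Integration.integral_cong) (simp_all add: count)
  moreover have "integrable M (\<lambda>\<omega>. real (padic_root_count p (f\<^sub>0 \<omega>))) \<longleftrightarrow> integrable M (\<lambda>\<omega>. real (N \<omega>))"
    by (rule Bochner_Integration.integrable_cong) (simp_all add: count)
  ultimately show ?thesis using int_N by (simp add: padic_mod_p_def)
qed

end
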